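(* Let $q\ge 3$ be an integer. For every (nondegenerate) subinterval $[c,d]\subseteq[-\lambda_q/2,\lambda_q/2]$, for all sufficiently large $N$ the equality $T_q^N([c,d])=[-\lambda_q/2,\lambda_q/2]$ holds up to a set of Lebesgue measure zero.
   Context: For an integer $q\ge3$, $\lambda_q=2\cos(\pi/q)$ and $I_q=[-\lambda_q/2,\lambda_q/2]$. The Rosen map $T_q:I_q\to I_q$ is $T_q(x)=\left|\frac1x\right|-\lambda_q\left\lfloor\left|\frac{1}{\lambda_q x}\right|+\frac12\right\rfloor$ for $x\ne0$, and $T_q(0)=0$. *)

theory Defs
  imports "HOL-Analysis.Analysis"
begin

definition rosen_lambda :: "nat \<Rightarrow> real" where
  "rosen_lambda q = 2 * cos (pi / real q)"

definition rosen_interval :: "nat \<Rightarrow> real set" where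
  "rosen_interval q = {- rosen_lambda q / 2 .. rosen_lambda q / 2}"

(* The same formula is used on all of real; only points of rosen_interval q,
   which the map sends into rosen_interval q for q \<ge> 3, are of interest. *)
definition rosen_map :: "nat \<Rightarrow> real \<Rightarrow> real" where
  "rosen_map q x =
     (if x = 0 then 0
      else \<bar>1 / x\<bar> - rosen_lambda q * of_int \<lfloor>\<bar>1 / (rosen_lambda q * x)\<bar> + 1 / 2\<rfloor>)"

definition eq_up_to_null :: "real set \<Rightarrow> real set \<Rightarrow> bool" where
  "eq_up_to_null A B \<longleftrightarrow> (A - B) \<union> (B - A) \<in> null_sets lebesgue"

end

theory Submission
  imports Defs
begin

text \<open>
  The map is even, so it may be replaced by the folded map \<open>F x = \<bar>T x\<bar>\<close>, the distance of \<open>1 / x\<close> to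
  the multiples of \<open>\<lambda>\<close>, which is continuous away from \<open>0\<close>. As long as the iterates of an interval under
  \<open>F\<close> avoid the turning values \<open>0\<close> and \<open>\<lambda> / 2\<close>, their length grows by the factor \<open>4 / \<lambda>\<^sup>2 > 1\<close>, so one
  of these values is eventually attained. The orbit of \<open>\<lambda> / 2\<close> ends in \<open>0\<close>, hence some iterate contains
  an interval \<open>[0, e]\<close>, and \<open>T\<close> maps every such interval onto \<open>[-\<lambda> / 2, \<lambda> / 2)\<close>.
\<close>

section \<open>The folded map and its branches\<close>

definition rosen_fold :: "nat \<Rightarrow> real \<Rightarrow> real" where
  "rosen_fold q x = \<bar>rosen_map q x\<bar>"

lemma rosen_lambda_bounds:
  assumes "q \<ge> 3"
  shows "1 \<le> rosen_lambda q" "rosen_lambda q < 2"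
proof -
  have "cos (pi / 3) \<le> cos (pi / real q)"
    using assms by (intro cos_monotone_0_pi_le) (auto simp: field_simps)
  then show "1 \<le> rosen_lambda q"
    by (simp add: rosen_lambda_def cos_60)
  have "cos (pi / real q) < cos 0"
    using assms by (intro cos_monotone_0_pi) (auto simp: field_simps)
  then show "rosen_lambda q < 2"
    by (simp add: rosen_lambda_def)
qed

lemma rosen_map_abs: "rosen_map q \<bar>x\<bar> = rosen_map q x"
  by (simp add: rosen_map_def abs_mult)

lemma rosen_fold_0 [simp]: "rosen_fold q 0 = 0"
  by (simp add: rosen_fold_def rosen_map_def)

text \<open>As \<open>rosen_map q\<close> is even, the absolute value semiconjugates it to
  \<open>rosen_fold q\<close>. This carries results on orbits of the folded map back to the original
  one.\<close>

lemma abs_funpow_rosen_map: "\<bar>(rosen_map q ^^ n) x\<bar> = (rosen_fold q ^^ n) \<bar>x\<bar>"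
proof (induction n)
  case (Suc n)
  then show ?case
    by (simp add: rosen_fold_def) (metis rosen_map_abs)
qed simp

lemma rosen_map_pos:
  assumes "q \<ge> 3" "x > 0"
  shows "rosen_map q x = 1 / x - rosen_lambda q * of_int \<lfloor>1 / x / rosen_lambda q + 1 / 2\<rfloor>"
  using assms rosen_lambda_bounds[OF assms(1)] by (simp add: rosen_map_def mult.commute)

lemma rosen_map_eqI:
  assumes q: "q \<ge> 3" and x: "x > 0"
    and k: "- rosen_lambda q / 2 \<le> 1 / x - rosen_lambda q * of_int k"
      "1 / x - rosen_lambda q * of_int k < rosen_lambda q / 2"
  shows "rosen_map q x = 1 / x - rosen_lambda q * of_int k"
proof -
  note l = rosen_lambda_bounds[OF q]
  define y where "y = 1 / x"
  have "\<lfloor>y / rosen_lambda q + 1 / 2\<rfloor> = k"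
    using k l unfolding y_def[symmetric] by (intro floor_unique) (simp_all add: field_simps)
  then show ?thesis
    using rosen_map_pos[OF q x] by (simp add: y_def)
qed

lemma rosen_map_range:
  assumes "q \<ge> 3"
  shows "rosen_map q x \<in> {- rosen_lambda q / 2..<rosen_lambda q / 2}"
proof (cases "x = 0")
  case True
  then show ?thesis
    using rosen_lambda_bounds[OF assms] by (simp add: rosen_map_def)
next
  case False
  define l where "l = rosen_lambda q"
  define t where "t = 1 / \<bar>x\<bar> / l"
  have l: "1 \<le> l"
    using rosen_lambda_bounds[OF assms] by (simp add: l_def)
  have "rosen_map q x = l * (t - of_int \<lfloor>t + 1 / 2\<rfloor>)"
    using rosen_map_pos[OF assms, of "\<bar>x\<bar>"] False l
    by (simp add: rosen_map_abs t_def l_def right_diff_distrib)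
  moreover have "- 1 / 2 \<le> t - of_int \<lfloor>t + 1 / 2\<rfloor>" "t - of_int \<lfloor>t + 1 / 2\<rfloor> < 1 / 2"
    by linarith+
  then have "l * (- 1 / 2) \<le> l * (t - of_int \<lfloor>t + 1 / 2\<rfloor>)"
    "l * (t - of_int \<lfloor>t + 1 / 2\<rfloor>) < l * (1 / 2)"
    using l by (intro mult_left_mono mult_strict_left_mono; simp)+
  ultimately show ?thesis
    by (simp add: l_def)
qed

lemma rosen_fold_range:
  assumes "q \<ge> 3"
  shows "0 \<le> rosen_fold q x" "rosen_fold q x \<le> rosen_lambda q / 2"
  using rosen_map_range[OF assms, of x] by (auto simp: rosen_fold_def)

text \<open>Unlike in \<open>rosen_map_eqI\<close>, the window for \<open>k\<close> is closed: at
  its right end the floor rounds up to \<open>k + 1\<close>, which only flips the sign of the value,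
  and folding hides this.\<close>

lemma rosen_fold_eqI:
  assumes q: "q \<ge> 3" and x: "x > 0"
    and k: "\<bar>1 / x - rosen_lambda q * of_int k\<bar> \<le> rosen_lambda q / 2"
  shows "rosen_fold q x = \<bar>1 / x - rosen_lambda q * of_int k\<bar>"
proof (cases "1 / x - rosen_lambda q * of_int k = rosen_lambda q / 2")
  case True
  then have "1 / x - rosen_lambda q * of_int (k + 1) = - rosen_lambda q / 2"
    by (simp add: algebra_simps)
  then show ?thesis
    using rosen_map_eqI[OF q x, of "k + 1"] rosen_lambda_bounds[OF q] True
    by (simp add: rosen_fold_def)
next
  case False
  then show ?thesis
    using rosen_map_eqI[OF q x, of k] k unfolding rosen_fold_def by linarith
qed

lemma rosen_fold_attained:
  assumes "q \<ge> 3" "x > 0"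
  obtains k :: int where "rosen_fold q x = \<bar>1 / x - rosen_lambda q * of_int k\<bar>"
  using rosen_map_pos[OF assms] by (auto simp: rosen_fold_def)

text \<open>Either \<open>k\<close> is a nearest multiple and equality holds, or the right side
  exceeds half of \<open>rosen_lambda q\<close>, which bounds the folded map.\<close>

lemma rosen_fold_le:
  assumes q: "q \<ge> 3" and x: "x > 0"
  shows "rosen_fold q x \<le> \<bar>1 / x - rosen_lambda q * of_int k\<bar>"
  using rosen_fold_eqI[OF q x, of k] rosen_fold_range(2)[OF q, of x] by linarith

section \<open>Continuity of the folded map and images of intervals\<close>

text \<open>Writing the folded map as a distance to a set yields its continuity on the positive
  reals without gluing branches.\<close>

lemma rosen_fold_infdist:
  assumes q: "q \<ge> 3" and x: "x > 0"
  shows "rosen_fold q x = infdist (1 / x) (range (\<lambda>k :: int. rosen_lambda q * of_int k))"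
proof (rule antisym)
  show "rosen_fold q x \<le> infdist (1 / x) (range (\<lambda>k :: int. rosen_lambda q * of_int k))"
    unfolding infdist_def
    by (auto intro!: cINF_greatest simp: dist_real_def rosen_fold_le[OF q x])
  show "infdist (1 / x) (range (\<lambda>k :: int. rosen_lambda q * of_int k)) \<le> rosen_fold q x"
    using rosen_fold_attained[OF q x]
    by (metis dist_real_def infdist_le rangeI)
qed

lemma continuous_on_rosen_fold:
  assumes "q \<ge> 3"
  shows "continuous_on {0<..} (rosen_fold q)"
proof -
  have "continuous_on {0<..}
    (\<lambda>x :: real. infdist (1 / x) (range (\<lambda>k :: int. rosen_lambda q * of_int k)))"
    by (intro continuous_intros) auto
  then show ?thesis
    by (rule continuous_on_eq) (simp add: rosen_fold_infdist[OF assms])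
qed

text \<open>Each integer \<open>k\<close> contributes at most two preimages. Consequently the folded
  map is constant on no interval of positive length.\<close>

lemma countable_rosen_fold_fiber:
  assumes "q \<ge> 3"
  shows "countable {x. x > 0 \<and> rosen_fold q x = s}"
proof -
  let ?A = "range (\<lambda>k :: int. 1 / (rosen_lambda q * of_int k + s)) \<union>
    range (\<lambda>k :: int. 1 / (rosen_lambda q * of_int k - s))"
  have "x \<in> ?A" if x: "x > 0" "rosen_fold q x = s" for x
  proof -
    obtain k :: int where "s = \<bar>1 / x - rosen_lambda q * of_int k\<bar>"
      using rosen_fold_attained[OF assms x(1)] x(2) by metis
    then have "1 / x = rosen_lambda q * of_int k + s \<or> 1 / x = rosen_lambda q * of_int k - s"
      by (auto simp: abs_if)
    then have "x = 1 / (rosen_lambda q * of_int k + s) \<or> x = 1 / (rosen_lambda q * of_int k - s)"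
      by (metis divide_divide_eq_right div_by_1 mult_1)
    then show ?thesis
      by blast
  qed
  then have "{x. x > 0 \<and> rosen_fold q x = s} \<subseteq> ?A"
    by blast
  then show ?thesis
    by (rule countable_subset) simp
qed

lemma rosen_fold_image_interval:
  assumes q: "q \<ge> 3" and ab: "0 < a" "a < b"
  obtains a' b' where "rosen_fold q ` {a..b} = {a'..b'}"
    "0 \<le> a'" "a' < b'" "b' \<le> rosen_lambda q / 2"
proof -
  have "continuous_on {a..b} (rosen_fold q)"
    by (rule continuous_on_subset[OF continuous_on_rosen_fold[OF q]]) (use ab in auto)
  then obtain a' b' where *: "rosen_fold q ` {a..b} = {a'..b'}" "a' \<le> b'"
    using continuous_image_closed_interval[of a b "rosen_fold q"] ab by auto
  have "a' \<noteq> b'"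
  proof
    assume "a' = b'"
    then have "{a..b} \<subseteq> {x. x > 0 \<and> rosen_fold q x = a'}"
      using * ab by auto
    then have "countable {a..b}"
      by (rule countable_subset) (rule countable_rosen_fold_fiber[OF q])
    then show False
      using ab uncountable_closed_interval[of a b] by simp
  qed
  moreover have "a' \<in> rosen_fold q ` {a..b}" "b' \<in> rosen_fold q ` {a..b}"
    using * by auto
  then have "0 \<le> a'" "b' \<le> rosen_lambda q / 2"
    using rosen_fold_range[OF q] by auto
  ultimately show ?thesis
    using that * by force
qed

section \<open>The finite orbit from the turning value lambda / 2 to 0\<close>

text \<open>In these coordinates one application of the folded map, on the branch
  \<open>k = 1\<close>, shifts the angle by pi / q. The upper bound on the angle keeps the cosines
  nonnegative, and the orbit reaches 0 when the angle in the numerator is pi / 2.\<close>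

lemma rosen_fold_orbit_cos_quotient:
  assumes q: "q \<ge> 3" and "t \<ge> 0" "t + real (Suc n) * (pi / real q) \<le> pi / 2"
  shows "(rosen_fold q ^^ n) (cos (t + pi / real q) / cos t)
    = cos (t + real (Suc n) * (pi / real q)) / cos (t + real n * (pi / real q))"
  using assms(3)
proof (induction n)
  case 0
  then show ?case
    by simp
next
  case (Suc n)
  define th where "th = pi / real q"
  define u where "u = t + real n * th"
  have th: "0 < th"
    using q by (simp add: th_def)
  have le: "u + 2 * th \<le> pi / 2"
    using Suc.prems by (simp add: u_def th_def[symmetric] algebra_simps)
  have u: "0 \<le> u"
    using assms(2) th by (simp add: u_def)
  have c: "0 < cos u" "0 < cos (u + th)" "0 \<le> cos (u + 2 * th)"
    using th u le by (auto intro!: cos_gt_zero_pi cos_ge_zero)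
  have l: "rosen_lambda q = 2 * cos th"
    by (simp add: rosen_lambda_def th_def)
  have sum: "cos u + cos (u + 2 * th) = 2 * cos th * cos (u + th)"
    using cos_add[of "u + th" th] cos_diff[of "u + th" th] by (simp add: algebra_simps)
  have eq: "1 / (cos (u + th) / cos u) - rosen_lambda q * of_int 1
      = - (cos (u + 2 * th) / cos (u + th))"
  proof -
    have "1 / (cos (u + th) / cos u) - rosen_lambda q * of_int 1
        = (cos u - 2 * cos th * cos (u + th)) / cos (u + th)"
      using c by (simp add: l diff_divide_distrib)
    also have "\<dots> = - (cos (u + 2 * th) / cos (u + th))"
      unfolding sum[symmetric] by simp
    finally show ?thesis .
  qed
  \<comment> \<open>This bounds the new quotient by \<open>cos th\<close>, half of
    \<open>rosen_lambda q\<close>, which certifies that 1 is a nearest multiple.\<close>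
  have "cos (u + 2 * th) = cos (u + th) * cos th - sin (u + th) * sin th"
    using cos_add[of "u + th" th] by (simp add: algebra_simps)
  moreover have "0 \<le> sin (u + th) * sin th"
    using th u le by (intro mult_nonneg_nonneg sin_ge_zero) auto
  ultimately have "cos (u + 2 * th) / cos (u + th) \<le> rosen_lambda q / 2"
    using c by (simp add: l field_simps)
  then have "rosen_fold q (cos (u + th) / cos u) = cos (u + 2 * th) / cos (u + th)"
    using rosen_fold_eqI[OF q, of "cos (u + th) / cos u" 1] c eq by (simp add: abs_le_iff)
  moreover have "(rosen_fold q ^^ n) (cos (t + th) / cos t) = cos (u + th) / cos u"
    using Suc th by (simp add: u_def th_def[symmetric] algebra_simps)
  moreover have "t + real (Suc n) * th = u + th" "t + real (Suc (Suc n)) * th = u + 2 * th"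
    by (simp_all add: u_def algebra_simps)
  ultimately show ?case
    by (simp add: th_def[symmetric])
qed

text \<open>The point is cos (pi / q) / cos 0, so the quotient formula with \<open>t = 0\<close>
  applies. For even \<open>q\<close> the angle hits pi / 2 exactly. For odd \<open>q\<close> it
  stops half a step short; one application on the branch \<open>k = 2\<close> then leads to a second
  run, starting at \<open>t = th / 2\<close>, which ends in 0.\<close>

lemma rosen_fold_orbit_endpoint:
  assumes q: "q \<ge> 3"
  obtains n where "(rosen_fold q ^^ n) (rosen_lambda q / 2) = 0"
proof -
  define th where "th = pi / real q"
  have th: "0 < th" "th \<le> pi / 3"
    using q by (auto simp: th_def field_simps)
  have l: "rosen_lambda q = 2 * cos th"
    by (simp add: rosen_lambda_def th_def)
  have qth: "real q * th = pi"
    using q by (simp add: th_def)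
  have start: "(rosen_fold q ^^ n) (rosen_lambda q / 2)
      = cos (real (Suc n) * th) / cos (real n * th)" if "real (Suc n) * th \<le> pi / 2" for n
    using rosen_fold_orbit_cos_quotient[OF q, of 0 n] that by (simp add: l th_def)
  show ?thesis
  proof (cases "even q")
    case True
    then obtain k where k: "q = 2 * k" by (elim evenE)
    then obtain m where m: "q = 2 * Suc m"
      using q by (cases k) auto
    then have m_th: "real (Suc m) * th = pi / 2"
      using qth by (simp add: algebra_simps)
    have "(rosen_fold q ^^ m) (rosen_lambda q / 2) = 0"
      using start[of m] unfolding m_th by simp
    then show ?thesis
      by (rule that)
  next
    case False
    then obtain k where k: "q = 2 * k + 1" by (elim oddE)
    then obtain m where m: "q = 2 * Suc m + 1"
      using q by (cases k) auto
    have half: "real m * th + 3 * (th / 2) = pi / 2"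
      using qth by (simp add: m algebra_simps)
    have s: "sin (th / 2) > 0" "cos (th / 2) > 0" "sin (3 * (th / 2)) > 0"
      using th by (auto intro!: sin_gt_zero cos_gt_zero_pi)
    have "sin (th + h) - sin (th - h) = 2 * cos th * sin h" for h
      by (simp add: sin_add sin_diff)
    from this[of "th / 2"] have s3: "sin (3 * (th / 2)) = (1 + rosen_lambda q) * sin (th / 2)"
      by (simp add: l algebra_simps)
    have "cos (th + h) + cos (th - h) = 2 * cos th * cos h" for h
      by (simp add: cos_add cos_diff)
    \<comment> \<open>So lambda - 1, the value reached after the branch \<open>k = 2\<close>, is the
      start of the quotient orbit with \<open>t = th / 2\<close>.\<close>
    from this[of "th / 2"] have c3: "cos (th / 2 + th) / cos (th / 2) = rosen_lambda q - 1"
      using s by (simp add: l field_simps)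
    have args: "real (Suc m) * th = pi / 2 - th / 2" "real m * th = pi / 2 - 3 * (th / 2)"
      using half by (simp_all add: algebra_simps)
    define x where "x = sin (th / 2) / sin (3 * (th / 2))"
    have x: "(rosen_fold q ^^ m) (rosen_lambda q / 2) = x"
      using start[of m] th unfolding args cos_sin_eq x_def by simp
    have "1 / x = 1 + rosen_lambda q"
      unfolding x_def s3 using s(1) by simp
    moreover have "x > 0"
      using s by (simp add: x_def)
    ultimately have "rosen_fold q x = rosen_lambda q - 1"
      using rosen_fold_eqI[OF q, of x 2] rosen_lambda_bounds[OF q] by simp
    moreover have "(rosen_fold q ^^ m) (rosen_lambda q - 1) = 0"
    proof -
      have e: "th / 2 + real (Suc m) * th = pi / 2"
        using half by (simp add: algebra_simps)
      show ?thesis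
        using rosen_fold_orbit_cos_quotient[OF q, of "th / 2" m] th
        unfolding th_def[symmetric] e c3 by simp
    qed
    ultimately have "(rosen_fold q ^^ (Suc m + m)) (rosen_lambda q / 2) = 0"
      using x by (simp only: funpow_add funpow_Suc_right o_apply)
    then show ?thesis
      by (rule that)
  qed
qed

section \<open>Growth of intervals until they contain a neighbourhood of 0 in the nonnegative
  reals\<close>

text \<open>An interval of nonnegative reals can contain 0 only as its left end, and then it is
  itself of the form [0, e]. Otherwise its image is again a nondegenerate interval, containing a
  point whose orbit reaches 0 one step sooner.\<close>

lemma rosen_fold_hits_zero:
  assumes q: "q \<ge> 3" and "0 \<le> a" "a < b" "x \<in> {a..b}" "(rosen_fold q ^^ m) x = 0"
  shows "\<exists>n e. e > 0 \<and> {0..e} \<subseteq> (rosen_fold q ^^ n) ` {a..b}"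
  using assms(2-)
proof (induction m arbitrary: a b x)
  case 0
  then show ?case
    by (intro exI[of _ 0] exI[of _ b]) auto
next
  case (Suc m)
  show ?case
  proof (cases "a = 0")
    case True
    then show ?thesis
      using Suc.prems by (intro exI[of _ 0] exI[of _ b]) auto
  next
    case False
    then have "0 < a"
      using Suc.prems(1) by simp
    then obtain a' b' where img: "rosen_fold q ` {a..b} = {a'..b'}" "0 \<le> a'" "a' < b'"
      using rosen_fold_image_interval[OF q _ Suc.prems(2)] by metis
    have x': "rosen_fold q x \<in> {a'..b'}"
      unfolding img(1)[symmetric] using Suc.prems(3) by (rule imageI)
    have orbit: "(rosen_fold q ^^ m) (rosen_fold q x) = 0"
      using Suc.prems(4) by (simp only: funpow_Suc_right o_apply)
    obtain n e where ne: "e > 0" "{0..e} \<subseteq> (rosen_fold q ^^ n) ` {a'..b'}"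
      using Suc.IH[OF img(2,3) x' orbit] by (elim exE conjE)
    have "{0..e} \<subseteq> (rosen_fold q ^^ Suc n) ` {a..b}"
      using ne(2) by (simp only: funpow_Suc_right image_comp[symmetric] img(1))
    then show ?thesis
      using ne(1) by (intro exI conjI)
  qed
qed

text \<open>Avoiding both turning values confines 1 / x to a gap between consecutive multiples of
  lambda / 2. There the folded map is 1 / x up to sign and a constant, and 1 / a - 1 / b = (b - a) /
  (a b) with a b at most lambda^2 / 4.\<close>

lemma rosen_fold_expands:
  assumes q: "q \<ge> 3" and ab: "0 < a" "a < b" "b \<le> rosen_lambda q / 2"
    and no: "\<And>x. x \<in> {a..b} \<Longrightarrow> rosen_fold q x \<noteq> 0"
      "\<And>x. x \<in> {a..b} \<Longrightarrow> rosen_fold q x \<noteq> rosen_lambda q / 2"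
  shows "4 / (rosen_lambda q)\<^sup>2 * (b - a) \<le> \<bar>rosen_fold q a - rosen_fold q b\<bar>"
proof -
  define l where "l = rosen_lambda q"
  have l: "1 \<le> l" "l < 2"
    using rosen_lambda_bounds[OF q] by (auto simp: l_def)
  \<comment> \<open>A multiple \<open>l * j / 2\<close> in the range of 1 / x would give the folded
    value 0 for even \<open>j\<close> and lambda / 2 for odd \<open>j\<close>.\<close>
  have half: "\<not> (1 / b \<le> l * of_int j / 2 \<and> l * of_int j / 2 \<le> 1 / a)" for j :: int
  proof
    assume j: "1 / b \<le> l * of_int j / 2 \<and> l * of_int j / 2 \<le> 1 / a"
    define x where "x = 1 / (l * of_int j / 2)"
    have "0 < 1 / b"
      using ab by simp
    then have pos: "0 < l * of_int j / 2"
      using j by linarith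
    then have x: "x > 0" "1 / x = l * of_int j / 2"
      by (simp_all add: x_def)
    have xab: "x \<in> {a..b}"
      using j x(1) ab unfolding x(2)[symmetric] by (simp add: field_simps)
    show False
    proof (cases "even j")
      case True
      then obtain k where "j = 2 * k" by (elim evenE)
      then show False
        using rosen_fold_eqI[OF q x(1), of k] x(2) l no(1)[OF xab] by (simp add: l_def)
    next
      case False
      then obtain k where "j = 2 * k + 1" by (elim oddE)
      then have "1 / x - l * of_int k = l / 2"
        using x(2) by (simp add: algebra_simps)
      then show False
        using rosen_fold_eqI[OF q x(1), of k] l no(2)[OF xab] by (simp add: l_def)
    qed
  qed
  \<comment> \<open>The gap containing 1 / b; its parity decides whether the branch is increasing or
    decreasing in 1 / x.\<close>
  define j where "j = \<lfloor>2 / (l * b)\<rfloor>"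
  have "of_int j \<le> 2 / (l * b)" "2 / (l * b) < of_int j + 1"
    by (simp_all add: j_def)
  then have j1: "l * of_int j / 2 \<le> 1 / b" "1 / b < l * of_int (j + 1) / 2"
    using l ab by (simp_all add: field_simps)
  have inv: "1 / b < 1 / a"
    using ab by (simp add: field_simps)
  have j2: "1 / a < l * of_int (j + 1) / 2"
    using half[of "j + 1"] j1 by linarith
  have lin: "\<bar>rosen_fold q a - rosen_fold q b\<bar> = 1 / a - 1 / b"
  proof (cases "even j")
    case True
    then obtain k where k: "j = 2 * k" by (elim evenE)
    have "rosen_fold q y = 1 / y - l * of_int k" if "y > 0" "1 / b \<le> 1 / y" "1 / y \<le> 1 / a" for y
      using rosen_fold_eqI[OF q \<open>y > 0\<close>, of k] that j1 j2
      unfolding l_def[symmetric] by (simp add: k algebra_simps)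
    from this[of a] this[of b] show ?thesis
      using inv ab by simp
  next
    case False
    then obtain k where k: "j = 2 * k + 1" by (elim oddE)
    have "rosen_fold q y = l * of_int (k + 1) - 1 / y"
      if "y > 0" "1 / b \<le> 1 / y" "1 / y \<le> 1 / a" for y
      using rosen_fold_eqI[OF q \<open>y > 0\<close>, of "k + 1"] that j1 j2
      unfolding l_def[symmetric] by (simp add: k algebra_simps)
    from this[of a] this[of b] show ?thesis
      using inv ab by simp
  qed
  have "a * b \<le> (l / 2) * (l / 2)"
    using ab by (intro mult_mono) (auto simp: l_def)
  then have "4 / l\<^sup>2 \<le> 1 / (a * b)"
    using ab l by (simp add: field_simps power2_eq_square)
  then have "4 / l\<^sup>2 * (b - a) \<le> 1 / (a * b) * (b - a)"
    using ab by (intro mult_right_mono) auto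
  also have "\<dots> = 1 / a - 1 / b"
    using ab by (simp add: field_simps)
  finally show ?thesis
    using lin by (simp add: l_def)
qed

text \<open>Here \<open>n\<close> bounds the number of expansions still possible: each uses up one
  factor, and at \<open>n = 0\<close> the interval would be longer than [0, lambda / 2]. So a
  turning value is met earlier, and its orbit ends in 0.\<close>

lemma rosen_fold_covers_zero_if_long:
  assumes q: "q \<ge> 3" and "0 \<le> a" "a < b" "b \<le> rosen_lambda q / 2"
    and "(4 / (rosen_lambda q)\<^sup>2) ^ n * (b - a) > rosen_lambda q / 2"
  shows "\<exists>k e. e > 0 \<and> {0..e} \<subseteq> (rosen_fold q ^^ k) ` {a..b}"
  using assms(2-)
proof (induction n arbitrary: a b)
  case 0
  then show ?case
    by simp
next
  case (Suc n)
  let ?r = "4 / (rosen_lambda q)\<^sup>2"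
  consider "a = 0" | x where "x \<in> {a..b}" "rosen_fold q x = 0"
    | x where "x \<in> {a..b}" "rosen_fold q x = rosen_lambda q / 2"
    | "0 < a" "\<And>x. x \<in> {a..b} \<Longrightarrow> rosen_fold q x \<noteq> 0"
      "\<And>x. x \<in> {a..b} \<Longrightarrow> rosen_fold q x \<noteq> rosen_lambda q / 2"
    using Suc.prems(1) by force
  then show ?case
  proof cases
    case 1
    then show ?thesis
      using rosen_fold_hits_zero[OF q, of a b 0 0] Suc.prems by simp
  next
    case 2
    then show ?thesis
      using rosen_fold_hits_zero[OF q, of a b x 1] Suc.prems by simp
  next
    case 3
    obtain m where "(rosen_fold q ^^ m) (rosen_lambda q / 2) = 0"
      using rosen_fold_orbit_endpoint[OF q] .
    then have "(rosen_fold q ^^ Suc m) x = 0"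
      using 3 by (simp only: funpow_Suc_right o_apply)
    then show ?thesis
      using rosen_fold_hits_zero[OF q _ _ 3(1)] Suc.prems by blast
  next
    case 4
    obtain a' b' where img: "rosen_fold q ` {a..b} = {a'..b'}" "0 \<le> a'" "a' < b'"
        "b' \<le> rosen_lambda q / 2"
      using rosen_fold_image_interval[OF q 4(1) Suc.prems(2)] .
    have "rosen_fold q a \<in> {a'..b'}" "rosen_fold q b \<in> {a'..b'}"
      using img(1) Suc.prems(2) by force+
    then have "\<bar>rosen_fold q a - rosen_fold q b\<bar> \<le> b' - a'"
      by auto
    then have "?r * (b - a) \<le> b' - a'"
      using rosen_fold_expands[OF q 4(1) Suc.prems(2,3) 4(2,3)] by linarith
    then have "?r ^ n * (?r * (b - a)) \<le> ?r ^ n * (b' - a')"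
      by (intro mult_left_mono) auto
    then have long: "?r ^ n * (b' - a') > rosen_lambda q / 2"
      using Suc.prems(4) by (simp only: power_Suc2 mult.assoc)
    obtain k e where ke: "e > 0" "{0..e} \<subseteq> (rosen_fold q ^^ k) ` {a'..b'}"
      using Suc.IH[OF img(2-4) long] by (elim exE conjE)
    have "{0..e} \<subseteq> (rosen_fold q ^^ Suc k) ` {a..b}"
      using ke(2) by (simp only: funpow_Suc_right image_comp[symmetric] img(1))
    then show ?thesis
      using ke(1) by (intro exI conjI)
  qed
qed

lemma rosen_fold_covers_zero:
  assumes q: "q \<ge> 3" and ab: "0 \<le> a" "a < b" "b \<le> rosen_lambda q / 2"
  obtains n e where "e > 0" "{0..e} \<subseteq> (rosen_fold q ^^ n) ` {a..b}"
proof -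
  let ?l = "rosen_lambda q"
  note l = rosen_lambda_bounds[OF q]
  have "?l\<^sup>2 < 2\<^sup>2"
    using l by (intro power_strict_mono) auto
  then have "1 < 4 / ?l\<^sup>2"
    using l by (simp add: field_simps)
  then obtain n where "?l / 2 / (b - a) < (4 / ?l\<^sup>2) ^ n"
    using real_arch_pow by blast
  then have "?l / 2 < (4 / ?l\<^sup>2) ^ n * (b - a)"
    using ab by (subst (asm) pos_divide_less_eq) auto
  then show ?thesis
    using rosen_fold_covers_zero_if_long[OF q ab] that by blast
qed

section \<open>Full branches near 0 and the conclusion\<close>

text \<open>Branches with large \<open>k\<close> are complete and lie arbitrarily close to 0. The
  right end is missing because rounding up at ties never produces the value lambda / 2.\<close>

lemma rosen_map_onto_near_zero:
  assumes q: "q \<ge> 3" and "e > 0"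
  shows "{- rosen_lambda q / 2..<rosen_lambda q / 2} \<subseteq> rosen_map q ` {0..e}"
proof
  fix y assume y: "y \<in> {- rosen_lambda q / 2..<rosen_lambda q / 2}"
  note l = rosen_lambda_bounds[OF q]
  \<comment> \<open>Since lambda is at least 1 and \<open>y\<close> is above -1, the extra 1 absorbs
    \<open>y\<close> and puts the preimage below \<open>e\<close>.\<close>
  obtain k :: nat where k: "real k > 1 / e + 1"
    using reals_Archimedean2 by blast
  have "1 * real k \<le> rosen_lambda q * real k"
    using l by (intro mult_right_mono) auto
  then have big: "1 / e < rosen_lambda q * real k + y"
    using k y l by auto
  define x where "x = 1 / (rosen_lambda q * real k + y)"
  have e: "0 < 1 / e"
    using assms by simp
  then have x: "x > 0" "1 / x = rosen_lambda q * of_int (int k) + y"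
    using big unfolding x_def by (smt (verit) zero_less_divide_1_iff, simp)
  have "x \<le> 1 / (1 / e)"
    unfolding x_def using big e by (intro divide_left_mono mult_pos_pos) linarith+
  moreover have "rosen_map q x = y"
    using rosen_map_eqI[OF q x(1), of "int k"] x(2) y by simp
  ultimately show "y \<in> rosen_map q ` {0..e}"
    using x(1) by (intro image_eqI[of _ _ x]) auto
qed

theorem theorem3:
  fixes q :: nat and c d :: real
  assumes "q \<ge> 3"
    and "c < d"
    and "{c..d} \<subseteq> rosen_interval q"
  shows "\<forall>\<^sub>F N in sequentially.
           eq_up_to_null ((rosen_map q ^^ N) ` {c..d}) (rosen_interval q)"
proof -
  define L where "L = rosen_lambda q / 2"
  have L: "0 < L"
    using rosen_lambda_bounds[OF assms(1)] by (simp add: L_def)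
  have I: "rosen_interval q = {- L..L}"
    by (simp add: rosen_interval_def L_def)
  have cd: "- L \<le> c" "d \<le> L"
    using assms(2,3) by (auto simp: I)
  \<comment> \<open>Keep the part of the interval on one side of 0, reflected if it is the negative
    side.\<close>
  obtain a b where ab: "0 \<le> a" "a < b" "b \<le> L" "{a..b} \<subseteq> abs ` {c..d}"
  proof (cases "d > 0")
    case True
    have "{max 0 c..d} \<subseteq> abs ` {c..d}"
      by (auto intro!: image_eqI)
    then show ?thesis
      using that[of "max 0 c" d] True assms(2) cd by simp
  next
    case False
    have "{- d..- c} \<subseteq> abs ` {c..d}"
    proof
      fix x assume "x \<in> {- d..- c}"
      then show "x \<in> abs ` {c..d}"
        using False by (intro image_eqI[of _ _ "- x"]) auto
    qed
    then show ?thesis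
      using that[of "- d" "- c"] False assms(2) cd by simp
  qed
  obtain n e where ne: "e > 0" "{0..e} \<subseteq> (rosen_fold q ^^ n) ` {a..b}"
    using rosen_fold_covers_zero[OF assms(1) ab(1,2)] ab(3) unfolding L_def by blast
  \<comment> \<open>Only absolute values of the \<open>n\<close>-th iterates are controlled;
    evenness makes one more application of \<open>rosen_map q\<close> insensitive to the lost
    signs.\<close>
  have "rosen_map q ` {0..e} \<subseteq> (rosen_map q ^^ Suc n) ` {c..d}"
  proof
    fix y assume "y \<in> rosen_map q ` {0..e}"
    then obtain z where "z \<in> {a..b}" "y = rosen_map q ((rosen_fold q ^^ n) z)"
      using ne(2) by blast
    then obtain x where "x \<in> {c..d}" "y = rosen_map q ((rosen_fold q ^^ n) \<bar>x\<bar>)"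
      using ab(4) by blast
    then show "y \<in> (rosen_map q ^^ Suc n) ` {c..d}"
      by (simp add: abs_funpow_rosen_map[symmetric] rosen_map_abs)
  qed
  then have first: "{- L..<L} \<subseteq> (rosen_map q ^^ Suc n) ` {c..d}"
    using rosen_map_onto_near_zero[OF assms(1) ne(1)] by (simp add: L_def)
  have covers: "{- L..<L} \<subseteq> (rosen_map q ^^ N) ` {c..d}" if "N \<ge> Suc n" for N
    using that
  proof (induction N rule: dec_induct)
    case base
    then show ?case
      by (rule first)
  next
    case (step N)
    \<comment> \<open>Coverage persists because a piece next to 0 already maps onto everything but
      the right end.\<close>
    have "{- L..<L} \<subseteq> rosen_map q ` {0..L / 2}"
      using rosen_map_onto_near_zero[OF assms(1), of "L / 2"] L by (simp add: L_def)
    also have "\<dots> \<subseteq> rosen_map q ` {- L..<L}"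
      using L by (intro image_mono) auto
    also have "\<dots> \<subseteq> rosen_map q ` (rosen_map q ^^ N) ` {c..d}"
      by (intro image_mono step.IH)
    finally show ?case
      by (simp add: image_image)
  qed
  have inside: "(rosen_map q ^^ N) ` {c..d} \<subseteq> {- L..L}" for N
  proof (cases N)
    case 0
    then show ?thesis
      using cd by auto
  next
    case (Suc m)
    have "rosen_map q x \<in> {- L..L}" for x
      using rosen_map_range[OF assms(1), of x] by (auto simp: L_def)
    then show ?thesis
      by (auto simp: Suc)
  qed
  have "eq_up_to_null ((rosen_map q ^^ N) ` {c..d}) (rosen_interval q)" if "N \<ge> Suc n" for N
  proof -
    \<comment> \<open>The sets can differ only in the right endpoint, a single point and hence a
      null set.\<close>
    have "((rosen_map q ^^ N) ` {c..d} - rosen_interval q) \<union>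
        (rosen_interval q - (rosen_map q ^^ N) ` {c..d}) \<subseteq> {L}"
      using covers[OF that] inside[of N] unfolding I by force
    then show ?thesis
      unfolding eq_up_to_null_def negligible_iff_null_sets[symmetric]
      by (rule negligible_subset[rotated]) simp
  qed
  then show ?thesis
    unfolding eventually_sequentially by blast
qed

end
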